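(* Let $G=(V,E)$ be a finite undirected unweighted graph (all conductances equal to $1$) with $n\ge 2$ vertices and $m\ge1$ edges, and fix an arbitrary orientation of each edge. For an edge $e$, let $i_e\in\mathbb{R}^E$ be the unit electric current flow from the tail $e^-$ to the head $e^+$ of $e$, i.e. $i_e=BL^+b_e$ in the notation below. Then $$\frac{1}{m}\sum_{e\in E}\|i_e\|_1\le 2\log n,$$ where $\log$ is the natural logarithm.
   Context: For a vertex $v$, $\mathbbm{1}_v\in\mathbb{R}^V$ is the standard basis vector. For an edge $e$ oriented from $e^-$ to $e^+$, $b_e:=\mathbbm{1}_{e^+}-\mathbbm{1}_{e^-}$. $B\in\mathbb{R}^{E\times V}$ is the signed incidence matrix whose row indexed by $e$ is $b_e^\top$. The Laplacian is $L=B^\top B$ (unweighted case) and $L^+$ is its Moore–Penrose pseudoinverse. The vector $i_e$ gives, for each edge $f$, the current $i_e(f)$ flowing on $f$ (in its chosen orientation) when a unit current is sent between the endpoints of $e$. Graphs have no self-loops; parallel edges are allowed. *)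

theory Defs
  imports "HOL-Analysis.Analysis"
begin

text \<open>Graph with vertex set the finite type 'v and edge set the finite type 'e
  (parallel edges allowed); each edge e is oriented from tail e to head e.\<close>

definition unit_vec :: "'v::finite \<Rightarrow> real^'v" where
  "unit_vec v = (\<chi> w. if w = v then 1 else 0)"

definition edge_vec :: "('e \<Rightarrow> 'v) \<Rightarrow> ('e \<Rightarrow> 'v) \<Rightarrow> 'e \<Rightarrow> real^'v::finite" where
  "edge_vec tail head e = unit_vec (head e) - unit_vec (tail e)"

definition incidence :: "('e::finite \<Rightarrow> 'v) \<Rightarrow> ('e \<Rightarrow> 'v) \<Rightarrow> real^'v::finite^'e" where
  "incidence tail head = (\<chi> e. edge_vec tail head e)"

definition laplacian :: "('e::finite \<Rightarrow> 'v) \<Rightarrow> ('e \<Rightarrow> 'v) \<Rightarrow> real^'v::finite^'v" where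
  "laplacian tail head = transpose (incidence tail head) ** incidence tail head"

definition is_pinv :: "real^'m::finite^'n::finite \<Rightarrow> real^'n^'m \<Rightarrow> bool" where
  "is_pinv A X \<longleftrightarrow> A ** X ** A = A \<and> X ** A ** X = X \<and>
     transpose (A ** X) = A ** X \<and> transpose (X ** A) = X ** A"

definition pinv :: "real^'m::finite^'n::finite \<Rightarrow> real^'n^'m" where
  "pinv A = (THE X. is_pinv A X)"

definition current :: "('e::finite \<Rightarrow> 'v::finite) \<Rightarrow> ('e \<Rightarrow> 'v) \<Rightarrow> 'e \<Rightarrow> real^'e" where
  "current tail head e = incidence tail head *v (pinv (laplacian tail head) *v edge_vec tail head e)"

definition l1norm :: "real^'e::finite \<Rightarrow> real" where
  "l1norm x = (\<Sum>f\<in>UNIV. \<bar>x $ f\<bar>)"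

end

theory Submission
  imports Defs
begin

text \<open>Let \<open>L\<close> be the Laplacian, \<open>D\<close> the degree matrix, and let \<open>y\<^sub>e\<close> solve \<open>L y\<^sub>e = b\<^sub>e\<close>; then
  \<open>i\<^sub>e(f)\<close> is the Dirichlet inner product of \<open>y\<^sub>e\<close> and \<open>y\<^sub>f\<close>. Integrating the decay of this inner
  product along the heat flow \<open>\<partial>\<^sub>t = - D\<^sup>-\<^sup>1 L\<close> gives
  \<open>\<Sum>\<^sub>e\<^sub>,\<^sub>f |i\<^sub>e(f)| \<le> 2 \<integral> \<Sum>\<^sub>v d\<^sub>v (\<Sum>\<^sub>e |\<nabla>\<^sub>e k\<^sub>t|)\<^sup>2 dt\<close>, where \<open>k\<^sub>t\<close> is the heat kernel density started
  at \<open>v\<close>. The logarithmic mean is at most the arithmetic mean, so by Cauchy-Schwarz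
  \<open>(\<Sum>\<^sub>e |\<nabla>\<^sub>e k|)\<^sup>2 \<le> (\<Sum>\<^sub>e \<nabla>\<^sub>e k \<nabla>\<^sub>e ln k) (\<Sum>\<^sub>x d\<^sub>x k(x) / 2)\<close>, where the second factor is \<open>1/2\<close>
  and the first is the rate at which the entropy of \<open>k\<^sub>t\<close> grows. The entropy grows by at most
  \<open>ln (2m / d\<^sub>v)\<close>, and \<open>\<Sum>\<^sub>v d\<^sub>v ln (2m / d\<^sub>v) \<le> 2m ln n\<close> since the degree distribution on \<open>n\<close> points has
  entropy at most \<open>ln n\<close>. The heat flow is replaced by implicit Euler steps of length \<open>\<epsilon>\<close>, for which
  the entropy inequality holds exactly and the energy identity up to \<open>O(\<epsilon>)\<close>; then \<open>\<epsilon> \<rightarrow> 0\<close>.\<close>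

section \<open>The pseudoinverse of a symmetric matrix\<close>

lemma inner_transpose_mult:
  fixes A :: "real^'m::finite^'n::finite"
  shows "inner (transpose A *v x) y = inner x (A *v y)"
  by (simp add: dot_lmul_matrix)

text \<open>Each of the symmetric projections \<open>A ** X\<close> and \<open>A ** Y\<close>
  absorbs the other, so transposing makes them equal; likewise for \<open>X ** A\<close> and
  \<open>Y ** A\<close>. Both candidates then equal \<open>X ** A ** Y\<close>.\<close>

lemma is_pinv_unique:
  assumes X: "is_pinv A X" and Y: "is_pinv A Y"
  shows "X = Y"
proof -
  have "X = X ** (A ** X)"
    using X by (simp add: is_pinv_def matrix_mul_assoc)
  also have "A ** X = (A ** Y) ** (A ** X)"
    using Y by (simp add: is_pinv_def matrix_mul_assoc)
  also have "(A ** Y) ** (A ** X) = transpose ((A ** X) ** (A ** Y))"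
    using X Y by (simp add: is_pinv_def matrix_transpose_mul)
  also have "(A ** X) ** (A ** Y) = A ** Y"
    using X by (simp add: is_pinv_def matrix_mul_assoc)
  also have "transpose (A ** Y) = A ** Y"
    using Y by (simp add: is_pinv_def)
  finally have 1: "X = (X ** A) ** Y"
    by (simp add: matrix_mul_assoc)
  have "Y = (Y ** A) ** Y"
    using Y by (simp add: is_pinv_def)
  also have "Y ** A = (Y ** A) ** (X ** A)"
    using X by (simp add: is_pinv_def flip: matrix_mul_assoc)
  also have "(Y ** A) ** (X ** A) = transpose ((X ** A) ** (Y ** A))"
    using X Y by (simp add: is_pinv_def matrix_transpose_mul)
  also have "(X ** A) ** (Y ** A) = X ** A"
    using Y by (simp add: is_pinv_def flip: matrix_mul_assoc)
  also have "transpose (X ** A) = X ** A"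
    using X by (simp add: is_pinv_def)
  finally show ?thesis
    using 1 by simp
qed

text \<open>A symmetric map is injective on its range, hence maps its range onto itself.\<close>

lemma symmetric_factor_square:
  fixes A :: "real^'n::finite^'n"
  assumes sym: "transpose A = A"
  obtains Y where "A ** A ** Y = A"
proof -
  let ?S = "range ((*v) A)"
  have lin: "linear ((*v) A)"
    by simp
  have sub: "subspace ?S"
    using lin by (simp add: linear_subspace_image)
  have adj: "inner (A *v x) y = inner x (A *v y)" for x y
    using inner_transpose_mult[of A x y] sym by simp
  have "x = 0" if "x \<in> ?S" "A *v x = 0" for x
  proof -
    from that obtain z where "x = A *v z" by blast
    then have "inner x x = inner z (A *v x)"
      by (simp add: adj)
    then show ?thesis
      using that by simp
  qed
  then have "inj_on ((*v) A) ?S"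
    unfolding linear_injective_on_subspace_0[OF lin sub] by blast
  moreover have "span ?S = ?S"
    using sub by (simp add: span_eq_iff)
  ultimately have "dim ((*v) A ` ?S) = dim ?S"
    by (intro dim_image_eq[OF lin]) (simp only:)
  moreover have "subspace ((*v) A ` ?S)"
    by (rule linear_subspace_image[OF lin sub])
  ultimately have onto: "(*v) A ` ?S = ?S"
    by (intro subspace_dim_equal[OF _ sub]) auto
  have "\<exists>w. A *v (A *v w) = column j A" for j
  proof -
    have "column j A \<in> ?S"
      by (metis matrix_vector_mult_basis rangeI)
    then show ?thesis
      using onto by (metis (no_types, lifting) imageE)
  qed
  then obtain w where w: "\<And>j. A *v (A *v w j) = column j A"
    by metis
  let ?Y = "(\<chi> i j. w j $ i) :: real^'n^'n"
  have "A ** A ** ?Y = A"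
  proof -
    have "(A ** A ** ?Y) $ i $ j = A $ i $ j" for i j
    proof -
      have "(A ** A ** ?Y) $ i $ j = ((A ** A) *v w j) $ i"
        by (simp add: matrix_matrix_mult_def[of "A ** A"] matrix_vector_mult_def)
      also have "(A ** A) *v w j = column j A"
        using w by (simp flip: matrix_vector_mul_assoc)
      finally show ?thesis
        by (simp add: column_def)
    qed
    then show ?thesis
      by (simp add: vec_eq_iff)
  qed
  then show ?thesis
    using that by blast
qed

text \<open>\<open>A ** Y\<close> is the orthogonal projection onto the range of \<open>A\<close>:
  transposing \<open>A ** A ** Y = A\<close> shows it symmetric. Applying it to \<open>Y\<close>
  yields the pseudoinverse.\<close>

lemma is_pinv_exists:
  fixes A :: "real^'n::finite^'n"
  assumes sym: "transpose A = A"
  shows "\<exists>X. is_pinv A X"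
proof -
  obtain Y where Y: "A ** A ** Y = A"
    using sym by (rule symmetric_factor_square)
  define Z where "Z = transpose Y"
  have Z: "Z ** A ** A = A"
    using arg_cong[OF Y, of transpose] sym
    by (simp add: matrix_transpose_mul Z_def matrix_mul_assoc)
  define P where "P = A ** Y"
  have P: "P = Z ** A"
    unfolding P_def using Y Z by (metis matrix_mul_assoc)
  have sP: "transpose P = P"
    using P sym by (metis P_def Z_def matrix_transpose_mul)
  have PA: "P ** A = A"
    using P Z by simp
  have AX: "A ** (P ** Y) = P"
    using Y by (simp add: P_def matrix_mul_assoc)
  have ZP: "P ** Y = Z ** P"
    using P by (metis P_def matrix_mul_assoc)
  have XA: "(P ** Y) ** A = P"
    unfolding ZP using P Z by (metis matrix_mul_assoc)
  have "P ** P = P"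
    by (metis P_def PA matrix_mul_assoc)
  then have "is_pinv A (P ** Y)"
    unfolding is_pinv_def AX XA by (simp add: PA sP matrix_mul_assoc)
  then show ?thesis ..
qed

lemma is_pinv_pinv:
  fixes A :: "real^'n::finite^'n"
  assumes "transpose A = A"
  shows "is_pinv A (pinv A)"
  unfolding pinv_def using is_pinv_exists[OF assms] is_pinv_unique by (metis theI)

section \<open>Gradient, degree and Laplacian\<close>

text \<open>The logarithmic mean is at most the arithmetic mean, multiplied out so that
  \<open>a = b\<close> is covered. Homogeneity reduces this to the ratio
  \<open>r = a / b\<close>.\<close>

lemma log_mean_le_arith_mean:
  fixes a b :: real
  assumes "0 < a" "0 < b"
  shows "(a - b)\<^sup>2 \<le> (a - b) * (ln a - ln b) * ((a + b) / 2)"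
proof -
  have *: "(a - b)\<^sup>2 \<le> (a - b) * (ln a - ln b) * ((a + b) / 2)" if "0 < b" "b \<le> a" for a b :: real
  proof -
    have ln_ge: "2 * (r - 1) \<le> ln r * (r + 1)" if "1 \<le> r" for r :: real
    proof -
      have "ln (1::real) * (1 + 1) - 2 * (1 - 1) \<le> ln r * (r + 1) - 2 * (r - 1)"
      proof (rule DERIV_nonneg_imp_nondecreasing[OF that])
        fix x :: real assume x: "1 \<le> x" "x \<le> r"
        have "((\<lambda>x. ln x * (x + 1) - 2 * (x - 1)) has_real_derivative
            (1 / x * (x + 1) + ln x - 2)) (at x)"
          using x by (auto intro!: derivative_eq_intros simp: field_simps)
        \<comment> \<open>The derivative equals \<open>1 / x - 1 - ln (1 / x)\<close>.\<close>
        moreover have "0 \<le> 1 / x * (x + 1) + ln x - 2"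
          using ln_le_minus_one[of "1 / x"] x by (simp add: ln_div field_simps)
        ultimately show "\<exists>y. ((\<lambda>x. ln x * (x + 1) - 2 * (x - 1)) has_real_derivative y) (at x) \<and> 0 \<le> y"
          by blast
      qed
      then show ?thesis by simp
    qed
    have "2 * (a - b) \<le> (ln a - ln b) * (a + b)"
    proof -
      have "2 * (a / b - 1) * b \<le> ln (a / b) * (a / b + 1) * b"
        using ln_ge[of "a / b"] that by (intro mult_right_mono) (auto simp: field_simps)
      moreover have "2 * (a / b - 1) * b = 2 * (a - b)" "(a / b + 1) * b = a + b"
        using that by (auto simp: field_simps)
      ultimately show ?thesis
        using that by (simp add: ln_div mult.assoc)
    qed
    from mult_left_mono[OF this, of "(a - b) / 2"] show ?thesis
      using that by (simp add: power2_eq_square field_simps)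
  qed
  show ?thesis
  proof (cases "b \<le> a")
    case True
    then show ?thesis using * assms by simp
  next
    case False
    then show ?thesis using *[of a b] assms
      by (simp add: power2_commute[of a b] algebra_simps)
  qed
qed

locale multigraph =
  fixes tail head :: "'e::finite \<Rightarrow> 'v::finite"
  assumes no_loop: "tail e \<noteq> head e"
begin

definition grad :: "real^'v \<Rightarrow> 'e \<Rightarrow> real" where
  "grad u e = u $ head e - u $ tail e"

definition lap :: "real^'v \<Rightarrow> real^'v" where
  "lap u = laplacian tail head *v u"

definition degree :: "'v \<Rightarrow> real" where
  "degree v = (\<Sum>e\<in>UNIV. (if head e = v then 1 else 0) + (if tail e = v then 1 else 0))"

lemma inner_unit_vec [simp]: "inner (unit_vec v) u = u $ v" "inner u (unit_vec v) = u $ v"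
  by (simp_all add: unit_vec_def inner_vec_def if_distrib[of "\<lambda>x. x * _"] if_distrib[of "(*) _"] cong: if_cong)

lemma unit_vec_nth: "unit_vec v $ w = (if w = v then 1 else 0)"
  by (simp add: unit_vec_def)

lemma inner_edge_vec: "inner (edge_vec tail head e) u = grad u e"
  by (simp add: edge_vec_def grad_def inner_diff_left)

lemma incidence_mult: "(incidence tail head *v u) $ e = grad u e"
  by (simp add: incidence_def matrix_vector_mul_component inner_edge_vec)

lemma inner_lap: "inner w (lap u) = (\<Sum>e\<in>UNIV. grad w e * grad u e)"
proof -
  have "inner w (lap u) = inner (incidence tail head *v w) (incidence tail head *v u)"
    unfolding lap_def laplacian_def
    by (metis inner_commute inner_transpose_mult matrix_vector_mul_assoc)
  then show ?thesis
    by (simp add: inner_vec_def incidence_mult)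
qed

lemma lap_nth: "lap u $ v = (\<Sum>e\<in>UNIV. grad (unit_vec v) e * grad u e)"
  using inner_lap[of "unit_vec v" u] by simp

lemma linear_lap: "linear lap"
  unfolding lap_def by simp

text \<open>Double counting: every edge is seen once from each endpoint.\<close>

lemma sum_degree: "(\<Sum>v\<in>UNIV. degree v * f v) = (\<Sum>e\<in>UNIV. f (head e) + f (tail e))"
proof -
  have "(\<Sum>v\<in>UNIV. degree v * f v) = (\<Sum>v\<in>UNIV. \<Sum>e\<in>UNIV. 
      ((if head e = v then f v else 0) + (if tail e = v then f v else 0)))"
    unfolding degree_def sum_distrib_right by (intro sum.cong refl) auto
  also have "\<dots> = (\<Sum>e\<in>UNIV. \<Sum>v\<in>UNIV. 
      ((if head e = v then f v else 0) + (if tail e = v then f v else 0)))"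
    by (rule sum.swap)
  finally show ?thesis
    by (simp add: sum.distrib)
qed

lemma degree_nonneg: "0 \<le> degree v"
  by (auto simp: degree_def intro: sum_nonneg)

lemma degree_total: "(\<Sum>v\<in>UNIV. degree v) = 2 * real CARD('e)"
  using sum_degree[of "\<lambda>_. 1"] by simp

lemma degree_pos_iff: "0 < degree v \<longleftrightarrow> (\<exists>e. head e = v \<or> tail e = v)"
proof -
  have "degree v = 0 \<longleftrightarrow> (\<forall>e. head e \<noteq> v \<and> tail e \<noteq> v)"
    unfolding degree_def by (subst sum_nonneg_eq_0_iff) auto
  then show ?thesis
    using degree_nonneg[of v] by (auto simp: less_le)
qed

lemma lap_isolated: "degree v = 0 \<Longrightarrow> lap u $ v = 0"
  using degree_pos_iff[of v] by (simp add: lap_nth grad_def unit_vec_nth)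

end

section \<open>The implicit Euler scheme for the heat flow\<close>

locale heat_scheme = multigraph tail head
  for tail head :: "'e::finite \<Rightarrow> 'v::finite" +
  fixes \<epsilon> :: real
  assumes eps_pos: "0 < \<epsilon>"
begin

text \<open>Isolated vertices get mass 1, so that the mass matrix is invertible.\<close>

definition mass :: "'v \<Rightarrow> real" where
  "mass v = (if degree v = 0 then 1 else degree v)"

definition mass_op :: "real^'v \<Rightarrow> real^'v" where
  "mass_op z = (\<chi> v. mass v * z $ v)"

definition euler_op :: "real^'v \<Rightarrow> real^'v" where
  "euler_op u = mass_op u + \<epsilon> *\<^sub>R lap u"

text \<open>One backward Euler step for \<open>M u' = - L u\<close>, where \<open>M\<close> is the
  mass matrix.\<close>

definition step :: "real^'v \<Rightarrow> real^'v" where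
  "step z = (THE u. euler_op u = mass_op z)"

definition dirichlet :: "real^'v \<Rightarrow> real^'v \<Rightarrow> real" where
  "dirichlet u w = (\<Sum>e\<in>UNIV. grad u e * grad w e)"

lemma mass_pos: "0 < mass v"
  using degree_nonneg[of v] by (auto simp: mass_def)

lemma inner_mass_op: "inner w (mass_op u) = (\<Sum>v\<in>UNIV. mass v * w $ v * u $ v)"
  by (simp add: mass_op_def inner_vec_def mult_ac)

lemma inner_mass_op_commute: "inner w (mass_op u) = inner (mass_op w) u"
  by (simp add: mass_op_def inner_vec_def mult_ac)

lemma linear_mass_op: "linear mass_op"
  by (rule linearI) (simp_all add: mass_op_def vec_eq_iff algebra_simps)

lemma linear_euler_op: "linear euler_op"
  unfolding euler_op_def
  by (intro linear_compose_add linear_compose_scale_right linear_mass_op linear_lap)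

lemma inner_lap_dirichlet: "inner w (lap u) = dirichlet w u"
  by (simp add: dirichlet_def inner_lap)

lemma dirichlet_commute: "dirichlet w u = dirichlet u w"
  by (simp add: dirichlet_def mult.commute)

lemma dirichlet_nonneg: "0 \<le> dirichlet u u"
  by (auto simp: dirichlet_def intro: sum_nonneg)

lemma inner_mass_op_nonneg: "0 \<le> inner u (mass_op u)"
  using mass_pos by (auto simp: inner_mass_op mult.assoc less_imp_le intro!: sum_nonneg)

lemma inner_euler_op: "inner w (euler_op u) = inner (euler_op w) u"
  by (simp add: euler_op_def inner_add_right inner_add_left inner_mass_op_commute
      inner_lap_dirichlet dirichlet_commute inner_commute[of "lap w"])

text \<open>Positive definiteness: pairing \<open>euler_op u = 0\<close> with \<open>u\<close> gives
  two nonnegative terms with sum 0, and the mass term vanishes only at \<open>u = 0\<close>.\<close>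

lemma inj_euler_op: "inj euler_op"
proof -
  have "u = 0" if "euler_op u = 0" for u
  proof -
    have "inner u (mass_op u) + \<epsilon> * dirichlet u u = 0"
      using arg_cong[OF that, of "inner u"]
      by (simp add: euler_op_def inner_add_right inner_lap_dirichlet)
    then have "inner u (mass_op u) = 0"
      using inner_mass_op_nonneg[of u] dirichlet_nonneg[of u] eps_pos
      by (smt (verit) mult_nonneg_nonneg)
    then have "mass v * u $ v * u $ v = 0" for v
      unfolding inner_mass_op using mass_pos
      by (subst (asm) sum_nonneg_eq_0_iff) (auto simp: mult.assoc less_imp_le)
    then show ?thesis
      using mass_pos by (simp add: vec_eq_iff) (metis less_irrefl)
  qed
  then show ?thesis
    using linear_euler_op by (simp add: linear_injective_0)
qed

lemma euler_op_step: "euler_op (step z) = mass_op z"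
proof -
  have "surj euler_op"
    using linear_euler_op inj_euler_op by (rule linear_inj_imp_surj)
  then obtain u where "euler_op u = mass_op z"
    by (metis surjD)
  then show ?thesis
    unfolding step_def by (rule theI) (metis inj_euler_op injD \<open>euler_op u = mass_op z\<close>)
qed

lemma step_eqI: "euler_op u = mass_op z \<Longrightarrow> u = step z"
  by (metis euler_op_step inj_euler_op injD)

text \<open>Symmetry of \<open>euler_op\<close> and \<open>mass_op\<close> makes \<open>step\<close>
  self-adjoint for the mass-weighted inner product.\<close>

lemma inner_step: "inner (step u) (mass_op w) = inner u (mass_op (step w))"
  by (metis euler_op_step inner_euler_op inner_mass_op_commute)

lemma inner_funpow_step: "inner ((step ^^ n) u) (mass_op w) = inner u (mass_op ((step ^^ n) w))"
  by (induction n arbitrary: w) (simp, simp add: inner_step, simp add: funpow_swap1)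

section \<open>Potentials and their energy along the scheme\<close>

lemma potential_step:
  assumes "lap y = mass_op u"
  shows "y = step y + \<epsilon> *\<^sub>R step u" and "lap (step y) = mass_op (step u)"
proof -
  \<comment> \<open>The difference quotient \<open>w\<close> is the candidate for
    \<open>step u\<close>: the Euler equation for \<open>y\<close> gives
    \<open>mass_op w = lap (step y)\<close>, and then \<open>w\<close> solves the equation that
    defines \<open>step u\<close>.\<close>
  define w where "w = (1 / \<epsilon>) *\<^sub>R (y - step y)"
  have w: "\<epsilon> *\<^sub>R w = y - step y"
    using eps_pos by (simp add: w_def)
  have "\<epsilon> *\<^sub>R mass_op w = mass_op y - mass_op (step y)"
    by (metis w linear_diff[OF linear_mass_op] linear_scale[OF linear_mass_op])
  also have "\<dots> = \<epsilon> *\<^sub>R lap (step y)"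
    using euler_op_step[of y] by (simp add: euler_op_def algebra_simps)
  finally have "\<epsilon> *\<^sub>R mass_op w = \<epsilon> *\<^sub>R lap (step y)" .
  then have Mw: "mass_op w = lap (step y)"
    using eps_pos by simp
  have "euler_op w = lap (step y) + lap (\<epsilon> *\<^sub>R w)"
    by (simp add: euler_op_def Mw linear_scale[OF linear_lap])
  also have "\<dots> = lap y"
    by (simp add: w linear_diff[OF linear_lap])
  finally have "w = step u"
    using assms by (intro step_eqI) simp
  then show "y = step y + \<epsilon> *\<^sub>R step u" "lap (step y) = mass_op (step u)"
    using w Mw by simp_all
qed

lemma potential_funpow:
  assumes "lap y = mass_op u"
  shows "lap ((step ^^ n) y) = mass_op ((step ^^ n) u)"
  using assms by (induction n) (simp_all add: potential_step(2))

text \<open>Expand bilinearly with \<open>y = step y + \<epsilon> *\<^sub>R step u\<close>. As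
  \<open>lap (step y) = mass_op (step u)\<close>, both cross terms are the same mass inner product;
  the quadratic term is the discretization error.\<close>

lemma dirichlet_drop:
  assumes "lap y = mass_op u" "lap y' = mass_op u'"
  shows "dirichlet y y' - dirichlet (step y) (step y')
    = 2 * \<epsilon> * inner (step u) (mass_op (step u')) + \<epsilon>\<^sup>2 * dirichlet (step u) (step u')"
proof -
  have "dirichlet (a + \<epsilon> *\<^sub>R b) (a' + \<epsilon> *\<^sub>R b')
      = dirichlet a a' + \<epsilon> * dirichlet b a' + \<epsilon> * dirichlet b' a + \<epsilon>\<^sup>2 * dirichlet b b'" for a a' b b'
    by (simp add: dirichlet_def grad_def algebra_simps sum.distrib sum_subtractf
        sum_distrib_left power2_eq_square)
  from this[of "step y" "step u" "step y'" "step u'"]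
  have "dirichlet y y' = dirichlet (step y) (step y') + \<epsilon> * dirichlet (step u) (step y')
      + \<epsilon> * dirichlet (step u') (step y) + \<epsilon>\<^sup>2 * dirichlet (step u) (step u')"
    using potential_step(1)[OF assms(1)] potential_step(1)[OF assms(2)] by simp
  moreover have "dirichlet (step u) (step y') = inner (step u) (mass_op (step u'))"
    using potential_step(2)[OF assms(2)] by (metis inner_lap_dirichlet)
  moreover have "dirichlet (step u') (step y) = inner (step u) (mass_op (step u'))"
    using potential_step(2)[OF assms(1)]
    by (metis inner_lap_dirichlet inner_commute inner_mass_op_commute)
  ultimately show ?thesis
    by simp
qed

lemma dirichlet_telescope:
  assumes "lap y = mass_op u" "lap y' = mass_op u'"
  shows "dirichlet y y' = dirichlet ((step ^^ n) y) ((step ^^ n) y')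
    + (\<Sum>t<n. 2 * \<epsilon> * inner ((step ^^ Suc t) u) (mass_op ((step ^^ Suc t) u'))
        + \<epsilon>\<^sup>2 * dirichlet ((step ^^ Suc t) u) ((step ^^ Suc t) u'))"
proof (induction n)
  case (Suc n)
  then show ?case
    using dirichlet_drop[OF potential_funpow potential_funpow, OF assms, of n n] by simp
qed simp

text \<open>Energy budget: telescoping with \<open>y' = y\<close>, where the error terms and the
  final energy are nonnegative. It yields both the decay of the sources and the bound on the
  discretization error.\<close>

lemma sum_mass_norm_le:
  assumes "lap y = mass_op u"
  shows "(\<Sum>t<n. 2 * \<epsilon> * inner ((step ^^ Suc t) u) (mass_op ((step ^^ Suc t) u))) \<le> dirichlet y y"
proof -
  have "(\<Sum>t<n. 2 * \<epsilon> * inner ((step ^^ Suc t) u) (mass_op ((step ^^ Suc t) u)))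
    \<le> (\<Sum>t<n. 2 * \<epsilon> * inner ((step ^^ Suc t) u) (mass_op ((step ^^ Suc t) u))
        + \<epsilon>\<^sup>2 * dirichlet ((step ^^ Suc t) u) ((step ^^ Suc t) u))"
    by (intro sum_mono) (simp add: dirichlet_nonneg del: funpow.simps)
  then show ?thesis
    using dirichlet_telescope[OF assms assms, of n] dirichlet_nonneg[of "(step ^^ n) y"]
    by simp
qed

text \<open>Brings the discretization error under the energy budget, through
  \<open>(a - b)^2 \<le> 2 a^2 + 2 b^2\<close> on each edge.\<close>

lemma dirichlet_le_mass_norm: "dirichlet u u \<le> 2 * inner u (mass_op u)"
proof -
  have "dirichlet u u \<le> (\<Sum>e\<in>UNIV. 2 * (u $ head e)\<^sup>2 + 2 * (u $ tail e)\<^sup>2)"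
    unfolding dirichlet_def grad_def
  proof (rule sum_mono)
    fix e
    show "(u $ head e - u $ tail e) * (u $ head e - u $ tail e) \<le> 2 * (u $ head e)\<^sup>2 + 2 * (u $ tail e)\<^sup>2"
      using zero_le_power2[of "u $ head e + u $ tail e"] by (simp add: power2_eq_square algebra_simps)
  qed
  also have "\<dots> = (\<Sum>v\<in>UNIV. degree v * (2 * (u $ v)\<^sup>2))"
    by (simp add: sum_degree)
  also have "\<dots> \<le> (\<Sum>v\<in>UNIV. mass v * (2 * (u $ v)\<^sup>2))"
    by (intro sum_mono mult_right_mono) (auto simp: mass_def)
  finally show ?thesis
    by (simp add: inner_mass_op sum_distrib_left power2_eq_square mult_ac)
qed

lemma abs_dirichlet_le: "\<bar>dirichlet u w\<bar> \<le> (dirichlet u u + dirichlet w w) / 2"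
proof -
  have "\<bar>dirichlet u w\<bar> \<le> (\<Sum>e\<in>UNIV. \<bar>grad u e * grad w e\<bar>)"
    unfolding dirichlet_def by (rule sum_abs)
  also have "\<dots> \<le> (\<Sum>e\<in>UNIV. (grad u e * grad u e + grad w e * grad w e) / 2)"
  proof (rule sum_mono)
    fix e
    show "\<bar>grad u e * grad w e\<bar> \<le> (grad u e * grad u e + grad w e * grad w e) / 2"
      using sum_squares_bound[of "\<bar>grad u e\<bar>" "\<bar>grad w e\<bar>"]
      by (simp add: power2_eq_square abs_mult)
  qed
  finally show ?thesis
    by (simp add: dirichlet_def sum.distrib flip: sum_divide_distrib)
qed

text \<open>The energy budget makes the sources tend to 0. The potentials may keep a constant on
  each component, so self-adjointness moves all steps onto the source: the energy is the pairing of
  the fixed \<open>y\<close> with \<open>(step ^^ (n + n)) u\<close>.\<close>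

lemma dirichlet_funpow_tendsto_0:
  assumes "lap y = mass_op u"
  shows "(\<lambda>n. dirichlet ((step ^^ n) y) ((step ^^ n) y)) \<longlonglongrightarrow> 0"
proof -
  define q where "q n = inner ((step ^^ n) u) (mass_op ((step ^^ n) u))" for n
  have q0: "0 \<le> q n" for n
    by (simp add: q_def inner_mass_op_nonneg)
  have "summable (\<lambda>t. 2 * \<epsilon> * q (Suc t))"
    using sum_mass_norm_le[OF assms] q0 eps_pos
    by (intro summableI_nonneg_bounded[where x = "dirichlet y y"])
      (auto simp: q_def simp del: funpow.simps)
  then have "(\<lambda>t. 2 * \<epsilon> * q (Suc t)) \<longlonglongrightarrow> 0"
    by (rule summable_LIMSEQ_zero)
  from tendsto_mult_right_zero[OF this, of "1 / (2 * \<epsilon>)"] have "q \<longlonglongrightarrow> 0"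
    using eps_pos by (simp add: filterlim_sequentially_Suc)
  have "(\<lambda>n. (step ^^ n) u $ v) \<longlonglongrightarrow> 0" for v
  proof -
    have "(\<lambda>n. ((step ^^ n) u $ v)\<^sup>2) \<longlonglongrightarrow> 0"
    proof (rule tendsto_sandwich[OF _ _ tendsto_const])
      show "(\<lambda>n. 1 / mass v * q n) \<longlonglongrightarrow> 0"
        using \<open>q \<longlonglongrightarrow> 0\<close> by (rule tendsto_mult_right_zero)
      have "mass v * ((step ^^ n) u $ v)\<^sup>2 \<le> q n" for n
        unfolding q_def inner_mass_op power2_eq_square mult.assoc[symmetric]
        using mass_pos by (intro member_le_sum) (auto simp: mult.assoc less_imp_le)
      then show "\<forall>\<^sub>F n in sequentially. ((step ^^ n) u $ v)\<^sup>2 \<le> 1 / mass v * q n"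
        using mass_pos[of v] by (simp add: field_simps)
    qed simp
    from tendsto_real_sqrt[OF this] show ?thesis
      by (simp add: tendsto_rabs_zero_iff)
  qed
  then have "(\<lambda>n. inner y (mass_op ((step ^^ n) u))) \<longlonglongrightarrow> 0"
    unfolding inner_mass_op by (intro tendsto_null_sum tendsto_mult_right_zero)
  then have "(\<lambda>n. inner y (mass_op ((step ^^ (n + n)) u))) \<longlonglongrightarrow> 0"
    by (rule filterlim_compose) (rule filterlim_at_top_mono[OF filterlim_ident], simp)
  moreover have "inner y (mass_op ((step ^^ (n + n)) u))
      = dirichlet ((step ^^ n) y) ((step ^^ n) y)" for n
    by (simp add: funpow_add potential_funpow[OF assms] flip: inner_funpow_step inner_lap_dirichlet)
  ultimately show ?thesis
    by simp
qed

section \<open>Minimum principle for the implicit step\<close>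

lemma degree_step: "degree x * step z $ x + \<epsilon> * lap (step z) $ x = degree x * z $ x"
proof (cases "degree x = 0")
  case False
  then show ?thesis
    using arg_cong[OF euler_op_step[of z], of "\<lambda>u. u $ x"]
    by (simp add: euler_op_def mass_op_def mass_def)
qed (simp add: lap_isolated)

lemma lap_term_nonpos:
  assumes "\<And>w. u $ x \<le> u $ w"
  shows "grad (unit_vec x) e * grad u e \<le> 0"
  using assms[of "head e"] assms[of "tail e"] no_loop[of e]
  by (auto simp: grad_def unit_vec_nth)

text \<open>At a minimizer \<open>x\<close> of the new function the Laplacian is at most 0, so the
  Euler equation at \<open>x\<close> bounds the minimum below by 0.\<close>

lemma step_nonneg:
  assumes "\<And>v. 0 \<le> z $ v"
  shows "0 \<le> step z $ v"
proof -
  let ?u = "step z"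
  obtain x where x: "\<And>w. ?u $ x \<le> ?u $ w"
  proof -
    have "Min (range (($) ?u)) \<in> range (($) ?u)"
      by (intro Min_in) auto
    then obtain x where x: "Min (range (($) ?u)) = ?u $ x"
      by (rule imageE)
    have "?u $ x \<le> ?u $ w" for w
      unfolding x[symmetric] by (intro Min_le) auto
    then show ?thesis
      by (rule that)
  qed
  have "lap ?u $ x \<le> 0"
    unfolding lap_nth by (intro sum_nonpos lap_term_nonpos x)
  then have "0 \<le> mass x * z $ x - \<epsilon> * lap ?u $ x"
    using assms[of x] mass_pos[of x] eps_pos
    by (smt (verit) mult_nonneg_nonneg mult_nonneg_nonpos)
  also have "\<dots> = mass x * ?u $ x"
    using arg_cong[OF euler_op_step[of z], of "\<lambda>u. u $ x"]
    by (simp add: euler_op_def mass_op_def)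
  finally have "0 \<le> ?u $ x"
    using mass_pos[of x] by (simp add: zero_le_mult_iff)
  then show ?thesis
    using x order_trans by blast
qed

text \<open>Strong minimum principle. A zero is a minimum, so the Laplacian there is at most 0, yet
  the Euler equation makes it nonnegative. Hence each of its edge terms, all of one sign, vanishes,
  and zeros spread to neighbours.\<close>

lemma step_eq_0:
  assumes nonneg: "\<And>v. 0 \<le> z $ v" and zero: "step z $ x = 0"
  shows "degree x * z $ x = 0"
    and "head e = x \<Longrightarrow> step z $ tail e = 0"
    and "tail e = x \<Longrightarrow> step z $ head e = 0"
proof -
  have min: "step z $ x \<le> step z $ w" for w
    using zero step_nonneg[OF nonneg] by simp
  have le: "lap (step z) $ x \<le> 0"
    unfolding lap_nth by (intro sum_nonpos lap_term_nonpos min)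
  have eq: "\<epsilon> * lap (step z) $ x = degree x * z $ x"
    using degree_step[of x z] zero by simp
  moreover have "0 \<le> degree x * z $ x"
    by (simp add: degree_nonneg nonneg)
  ultimately have lap0: "lap (step z) $ x = 0"
    using le eps_pos by (simp add: zero_le_mult_iff flip: eq)
  then show "degree x * z $ x = 0"
    using eq by simp
  have "grad (unit_vec x) e * grad (step z) e = 0" for e
  proof -
    have "(\<Sum>e\<in>UNIV. - (grad (unit_vec x) e * grad (step z) e)) = 0"
      using lap0 by (simp add: lap_nth sum_negf)
    then show ?thesis
      using lap_term_nonpos[of "step z" x, OF min] by (subst (asm) sum_nonneg_eq_0_iff) auto
  qed
  from this[of e] show "head e = x \<Longrightarrow> step z $ tail e = 0" "tail e = x \<Longrightarrow> step z $ head e = 0"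
    using zero no_loop[of e] by (auto simp: grad_def unit_vec_nth)
qed

section \<open>Entropy along the heat flow\<close>

definition density :: "real^'v \<Rightarrow> bool" where
  "density k \<longleftrightarrow> (\<forall>v. 0 \<le> k $ v) \<and> (\<Sum>v\<in>UNIV. degree v * k $ v) = 1"

definition neg_entropy :: "real^'v \<Rightarrow> real" where
  "neg_entropy k = (\<Sum>v\<in>UNIV. degree v * (k $ v * ln (k $ v)))"

text \<open>Discrete Fisher information, the Dirichlet pairing of \<open>k\<close> with
  \<open>ln k\<close>: the rate at which the heat flow produces entropy.\<close>

definition fisher :: "real^'v \<Rightarrow> real" where
  "fisher k = (\<Sum>e\<in>UNIV. grad k e * (ln (k $ head e) - ln (k $ tail e)))"

lemma density_step:
  assumes "density k"
  shows "density (step k)"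
proof -
  have "(\<Sum>x\<in>UNIV. lap (step k) $ x) = inner 1 (lap (step k))"
    by (simp add: inner_vec_def)
  also have "\<dots> = 0"
    by (simp add: inner_lap grad_def)
  finally have "(\<Sum>x\<in>UNIV. degree x * step k $ x) = (\<Sum>x\<in>UNIV. degree x * step k $ x + \<epsilon> * lap (step k) $ x)"
    by (simp add: sum.distrib flip: sum_distrib_left)
  then show ?thesis
    using assms step_nonneg[of k] by (simp add: density_def degree_step)
qed

lemma density_funpow: "density k \<Longrightarrow> density ((step ^^ n) k)"
  by (induction n) (simp_all add: density_step)

text \<open>Convexity of \<open>x ln x\<close>, evaluated at the new point: this is what makes the implicit scheme
  lose no constant against the continuous flow. The junk value \<open>ln 0 = 0\<close> is
  harmless, since \<open>step k\<close> vanishes at both ends of an edge or at none.\<close>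

lemma neg_entropy_step:
  assumes "density k"
  shows "\<epsilon> * fisher (step k) \<le> neg_entropy k - neg_entropy (step k)"
proof -
  have nonneg: "\<And>v. 0 \<le> k $ v" and "\<And>v. 0 \<le> step k $ v"
    using assms density_step[OF assms] by (auto simp: density_def)
  \<comment> \<open>The derivative of \<open>x ln x\<close> at the new point; its summand 1
    disappears in every gradient.\<close>
  let ?l = "(\<chi> v. ln (step k $ v) + 1) :: real^'v"
  have "\<epsilon> * fisher (step k) = \<epsilon> * inner ?l (lap (step k))"
    by (simp add: inner_lap fisher_def grad_def mult.commute)
  also have "\<dots> = (\<Sum>v\<in>UNIV. (ln (step k $ v) + 1) * (\<epsilon> * lap (step k) $ v))"
    by (simp add: inner_vec_def sum_distrib_left mult_ac)
  also have "\<dots> = (\<Sum>v\<in>UNIV. (ln (step k $ v) + 1) * (degree v * k $ v - degree v * step k $ v))"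
  proof (intro sum.cong refl arg_cong2[where f = "(*)"])
    fix v
    show "\<epsilon> * lap (step k) $ v = degree v * k $ v - degree v * step k $ v"
      using degree_step[of v k] by simp
  qed
  also have "\<dots> \<le> (\<Sum>v\<in>UNIV. degree v * (k $ v * ln (k $ v)) - degree v * (step k $ v * ln (step k $ v)))"
  proof (rule sum_mono)
    fix v
    let ?a = "k $ v" and ?b = "step k $ v"
    show "(ln ?b + 1) * (degree v * ?a - degree v * ?b) \<le> degree v * (?a * ln ?a) - degree v * (?b * ln ?b)"
    proof (cases "?b = 0")
      case True
      then show ?thesis
        using step_eq_0(1)[OF nonneg True] by auto
    next
      case False
      then have b: "0 < ?b"
        using \<open>0 \<le> ?b\<close> by simp
      have "(ln ?b + 1) * (?a - ?b) \<le> ?a * ln ?a - ?b * ln ?b"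
      proof (cases "?a = 0")
        case False
        then have a: "0 < ?a"
          using nonneg[of v] by simp
        have "?a * ln (?b / ?a) \<le> ?a * (?b / ?a - 1)"
          using a b by (intro mult_left_mono ln_le_minus_one) auto
        then show ?thesis
          using a b by (simp add: ln_div algebra_simps)
      qed (use b in \<open>simp add: algebra_simps\<close>)
      from mult_left_mono[OF this degree_nonneg[of v]] show ?thesis
        by (simp add: algebra_simps)
    qed
  qed
  finally show ?thesis
    by (simp add: neg_entropy_def sum_subtractf)
qed

text \<open>Gibbs' inequality against the uniform density \<open>1 / m\<close>, where
  \<open>m\<close> is the total degree; the first-order terms cancel because both densities have
  mass 1.\<close>

lemma neg_entropy_ge:
  assumes "density k"
  shows "- ln (2 * real CARD('e)) \<le> neg_entropy k"
proof -
  define m where "m = 2 * real CARD('e)"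
  have m: "0 < m"
    by (simp add: m_def)
  have "0 = (\<Sum>v\<in>UNIV. degree v * (k $ v - 1 / m))"
    using assms degree_total m
    by (simp add: density_def right_diff_distrib sum_subtractf flip: sum_divide_distrib m_def)
  also have "\<dots> \<le> (\<Sum>v\<in>UNIV. degree v * (k $ v * ln (k $ v) + ln m * k $ v))"
  proof (intro sum_mono mult_left_mono degree_nonneg)
    fix v
    show "k $ v - 1 / m \<le> k $ v * ln (k $ v) + ln m * k $ v"
    proof (cases "k $ v = 0")
      case False
      then have a: "0 < k $ v"
        using assms by (simp add: density_def less_le)
      have "k $ v * ln (1 / (m * k $ v)) \<le> k $ v * (1 / (m * k $ v) - 1)"
        using a m by (intro mult_left_mono ln_le_minus_one) auto
      then show ?thesis
        using a m by (simp add: ln_div ln_mult algebra_simps)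
    qed (use m in simp)
  qed
  also have "\<dots> = neg_entropy k + ln m"
    using assms
    by (simp add: neg_entropy_def density_def distrib_left sum.distrib mult.left_commute[of _ "ln m"]
        flip: sum_distrib_left)
  finally show ?thesis
    by (simp add: m_def)
qed

lemma grad_norm_le_fisher:
  assumes "density k"
  shows "(\<Sum>e\<in>UNIV. \<bar>grad (step k) e\<bar>)\<^sup>2 \<le> fisher (step k) / 2"
proof -
  define u where "u = step k"
  have u: "\<And>v. 0 \<le> u $ v" and total: "(\<Sum>v\<in>UNIV. degree v * u $ v) = 1"
    using density_step[OF assms] by (auto simp: density_def u_def)
  define p where "p e = grad u e * (ln (u $ head e) - ln (u $ tail e))" for e
  define q where "q e = (u $ head e + u $ tail e) / 2" for e
  have pq: "0 \<le> p e \<and> \<bar>grad u e\<bar> \<le> sqrt (p e) * sqrt (q e)" for e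
  \<comment> \<open>After a step, a zero at one end of an edge forces a zero at the other, so the
    inequality of means is only applied to positive values.\<close>
  proof (cases "u $ head e = 0 \<or> u $ tail e = 0")
    case True
    then have "u $ head e = 0" "u $ tail e = 0"
      using step_eq_0(2,3)[of k _ e] assms by (auto simp: u_def density_def)
    then show ?thesis
      by (simp add: p_def grad_def q_def)
  next
    case False
    then have pos: "0 < u $ head e" "0 < u $ tail e"
      using u by (simp_all add: less_le)
    have "0 \<le> p e"
      using pos unfolding p_def grad_def by (cases "u $ head e \<le> u $ tail e") (auto simp: mult_nonpos_nonpos)
    moreover have "(grad u e)\<^sup>2 \<le> p e * q e"
      using log_mean_le_arith_mean[OF pos] by (simp add: p_def q_def grad_def)
    then have "\<bar>grad u e\<bar> \<le> sqrt (p e * q e)"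
      using real_sqrt_le_mono real_sqrt_abs by metis
    ultimately show ?thesis
      by (simp add: real_sqrt_mult)
  qed
  have q: "0 \<le> q e" for e
    by (simp add: q_def u)
  have "(\<Sum>e\<in>UNIV. \<bar>grad u e\<bar>)\<^sup>2 \<le> (\<Sum>e\<in>UNIV. sqrt (p e) * sqrt (q e))\<^sup>2"
    using pq by (intro power_mono sum_mono sum_nonneg) auto
  also have "\<dots> \<le> (\<Sum>e\<in>UNIV. (sqrt (p e))\<^sup>2) * (\<Sum>e\<in>UNIV. (sqrt (q e))\<^sup>2)"
    by (rule Cauchy_Schwarz_ineq_sum)
  also have "\<dots> = (\<Sum>e\<in>UNIV. p e) * (\<Sum>e\<in>UNIV. q e)"
    using pq q by simp
  also have "(\<Sum>e\<in>UNIV. q e) = 1 / 2"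
    using total by (simp add: q_def sum_degree flip: sum_divide_distrib)
  finally show ?thesis
    by (simp add: u_def p_def fisher_def)
qed

lemma sum_fisher_le:
  assumes "density k"
  shows "(\<Sum>t<n. \<epsilon> * fisher ((step ^^ Suc t) k)) \<le> neg_entropy k + ln (2 * real CARD('e))"
proof -
  have "(\<Sum>t<n. \<epsilon> * fisher ((step ^^ Suc t) k)) \<le> neg_entropy k - neg_entropy ((step ^^ n) k)"
  proof (induction n)
    case (Suc n)
    then show ?case
      using neg_entropy_step[OF density_funpow[OF assms], of n] by simp
  qed simp
  then show ?thesis
    using neg_entropy_ge[OF density_funpow[OF assms], of n] by simp
qed

definition point_mass :: "'v \<Rightarrow> real^'v" where
  "point_mass v = (1 / mass v) *\<^sub>R unit_vec v"

lemma density_point_mass: "0 < degree v \<Longrightarrow> density (point_mass v)"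
  by (simp add: density_def point_mass_def unit_vec_nth mass_def if_distrib cong: if_cong)

lemma neg_entropy_point_mass: "0 < degree v \<Longrightarrow> neg_entropy (point_mass v) = - ln (degree v)"
  by (simp add: neg_entropy_def point_mass_def unit_vec_nth mass_def if_distrib ln_div cong: if_cong)

lemma inner_point_mass: "inner (point_mass v) (mass_op w) = w $ v"
  using mass_pos[of v] by (simp add: point_mass_def mass_op_def)

section \<open>The sum of the absolute values of the transfer currents\<close>

text \<open>The edge vector divided by the masses, which turns \<open>L y = b_e\<close> into the
  form \<open>lap y = mass_op u\<close> that the scheme propagates.\<close>

definition source :: "'e \<Rightarrow> real^'v" where
  "source e = (\<chi> v. edge_vec tail head e $ v / mass v)"

lemma mass_op_source: "mass_op (source e) = edge_vec tail head e"
  using mass_pos by (simp add: mass_op_def source_def vec_eq_iff less_imp_neq[symmetric])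

text \<open>Self-adjointness trades the evolution of the dipole at \<open>e\<close> for that of the
  point mass at \<open>v\<close>, so that one density per vertex serves all edges at once.\<close>

lemma funpow_source_nth: "(step ^^ n) (source e) $ v = grad ((step ^^ n) (point_mass v)) e"
proof -
  have "(step ^^ n) (source e) $ v = inner (point_mass v) (mass_op ((step ^^ n) (source e)))"
    by (simp add: inner_point_mass)
  also have "\<dots> = inner ((step ^^ n) (point_mass v)) (edge_vec tail head e)"
    by (simp add: mass_op_source flip: inner_funpow_step)
  finally show ?thesis
    by (simp add: inner_commute flip: inner_edge_vec)
qed

text \<open>Gibbs' inequality for the degree distribution against the uniform distribution on the
  vertices; the slack \<open>m / n - degree v\<close> sums to 0.\<close>

lemma degree_entropy_le:
  "(\<Sum>v\<in>UNIV. degree v * (ln (2 * real CARD('e)) - ln (degree v))) \<le> 2 * real CARD('e) * ln (real CARD('v))"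
proof -
  define m where "m = 2 * real CARD('e)"
  define n where "n = real CARD('v)"
  have pos: "0 < m" "0 < n"
    by (simp_all add: m_def n_def)
  have "(\<Sum>v\<in>UNIV. degree v * (ln m - ln (degree v))) \<le> (\<Sum>v\<in>UNIV. degree v * ln n + (m / n - degree v))"
  proof (rule sum_mono)
    fix v
    show "degree v * (ln m - ln (degree v)) \<le> degree v * ln n + (m / n - degree v)"
    proof (cases "degree v = 0")
      case False
      then have d: "0 < degree v"
        using degree_nonneg[of v] by simp
      have "degree v * ln (m / (n * degree v)) \<le> degree v * (m / (n * degree v) - 1)"
        using d pos by (intro mult_left_mono ln_le_minus_one) auto
      then show ?thesis
        using d pos by (simp add: ln_div ln_mult algebra_simps)
    qed (use pos in simp)
  qed
  also have "\<dots> = m * ln n"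
    using pos degree_total
    by (simp add: sum.distrib sum_subtractf m_def n_def flip: sum_distrib_right)
  finally show ?thesis
    by (simp add: m_def n_def)
qed

lemma sum_transfer_current_le_eps:
  assumes y: "\<And>e. lap (y e) = edge_vec tail head e"
  shows "(\<Sum>e\<in>UNIV. \<Sum>f\<in>UNIV. \<bar>dirichlet (y e) (y f)\<bar>)
    \<le> 2 * real CARD('e) * ln (real CARD('v))
      + \<epsilon> * (\<Sum>e\<in>UNIV. \<Sum>f\<in>UNIV. (dirichlet (y e) (y e) + dirichlet (y f) (y f)) / 2)"
    (is "?F \<le> ?H + \<epsilon> * ?C")
proof -
  have lap_y: "lap (y e) = mass_op (source e)" for e
    by (simp add: y mass_op_source)
  define u where "u t e = (step ^^ Suc t) (source e)" for t e
  define k where "k t v = (step ^^ t) (point_mass v)" for t v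
  \<comment> \<open>Bound on the energy that remains after \<open>n\<close> steps.\<close>
  define R where "R n = (\<Sum>e\<in>UNIV. \<Sum>f\<in>UNIV.
    (dirichlet ((step ^^ n) (y e)) ((step ^^ n) (y e))
      + dirichlet ((step ^^ n) (y f)) ((step ^^ n) (y f))) / 2)" for n
  have u_nth: "u t e $ v = grad (k (Suc t) v) e" for t e v
    unfolding u_def k_def by (rule funpow_source_nth)
  have main: "(\<Sum>e\<in>UNIV. \<Sum>f\<in>UNIV. 2 * \<epsilon> * \<bar>inner (u t e) (mass_op (u t f))\<bar>)
      \<le> (\<Sum>v\<in>UNIV. degree v * (\<epsilon> * fisher (k (Suc t) v)))" for t
  proof -
    \<comment> \<open>The artificial mass 1 of an isolated vertex does no harm, since evolved
      sources vanish there.\<close>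
    have "mass_op (u t f) $ v = 0" if "degree v = 0" for f v
      using potential_funpow[OF lap_y, of "Suc t" f] lap_isolated[OF that] by (metis u_def)
    then have iso: "mass v * u t e $ v * u t f $ v = degree v * (u t e $ v * u t f $ v)" for e f v
      by (cases "degree v = 0") (auto simp: mass_op_def mass_def)
    have "(\<Sum>e\<in>UNIV. \<Sum>f\<in>UNIV. \<bar>inner (u t e) (mass_op (u t f))\<bar>)
        \<le> (\<Sum>e\<in>UNIV. \<Sum>f\<in>UNIV. \<Sum>v\<in>UNIV. degree v * (\<bar>u t e $ v\<bar> * \<bar>u t f $ v\<bar>))"
      unfolding inner_mass_op iso
      by (intro sum_mono order_trans[OF sum_abs]) (simp add: abs_mult degree_nonneg)
    also have "\<dots> = (\<Sum>e\<in>UNIV. \<Sum>v\<in>UNIV. \<Sum>f\<in>UNIV. degree v * (\<bar>u t e $ v\<bar> * \<bar>u t f $ v\<bar>))"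
      by (intro sum.cong refl sum.swap)
    also have "\<dots> = (\<Sum>v\<in>UNIV. \<Sum>e\<in>UNIV. \<Sum>f\<in>UNIV. degree v * (\<bar>u t e $ v\<bar> * \<bar>u t f $ v\<bar>))"
      by (rule sum.swap)
    \<comment> \<open>At each vertex the sum over pairs of edges factors into a square, to which the
      Fisher bound applies.\<close>
    also have "\<dots> = (\<Sum>v\<in>UNIV. degree v * (\<Sum>e\<in>UNIV. \<bar>u t e $ v\<bar>)\<^sup>2)"
      unfolding power2_eq_square sum_product by (simp only: sum_distrib_left)
    also have "\<dots> \<le> (\<Sum>v\<in>UNIV. degree v * (fisher (k (Suc t) v) / 2))"
    proof (rule sum_mono)
      fix v
      show "degree v * (\<Sum>e\<in>UNIV. \<bar>u t e $ v\<bar>)\<^sup>2 \<le> degree v * (fisher (k (Suc t) v) / 2)"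
      proof (cases "degree v = 0")
        case False
        then have "density (k t v)"
          using degree_nonneg[of v] by (simp add: k_def density_funpow density_point_mass)
        from grad_norm_le_fisher[OF this] show ?thesis
          by (intro mult_left_mono degree_nonneg) (simp add: u_nth k_def)
      qed simp
    qed
    finally have "(\<Sum>e\<in>UNIV. \<Sum>f\<in>UNIV. \<bar>inner (u t e) (mass_op (u t f))\<bar>)
        \<le> (\<Sum>v\<in>UNIV. degree v * (fisher (k (Suc t) v) / 2))" .
    from mult_left_mono[OF this, of "2 * \<epsilon>"] show ?thesis
      using eps_pos by (simp add: sum_distrib_left mult_ac)
  qed
  have entropy: "(\<Sum>t<n. \<Sum>v\<in>UNIV. degree v * (\<epsilon> * fisher (k (Suc t) v))) \<le> ?H" for n
  proof -
    have "(\<Sum>t<n. \<Sum>v\<in>UNIV. degree v * (\<epsilon> * fisher (k (Suc t) v)))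
        = (\<Sum>v\<in>UNIV. degree v * (\<Sum>t<n. \<epsilon> * fisher (k (Suc t) v)))"
      unfolding sum_distrib_left by (rule sum.swap)
    also have "\<dots> \<le> (\<Sum>v\<in>UNIV. degree v * (ln (2 * real CARD('e)) - ln (degree v)))"
    proof (rule sum_mono)
      fix v
      show "degree v * (\<Sum>t<n. \<epsilon> * fisher (k (Suc t) v))
          \<le> degree v * (ln (2 * real CARD('e)) - ln (degree v))"
      proof (cases "degree v = 0")
        case False
        then have "0 < degree v"
          using degree_nonneg[of v] by simp
        from sum_fisher_le[OF density_point_mass[OF this], of n] show ?thesis
          using neg_entropy_point_mass[OF \<open>0 < degree v\<close>]
          by (intro mult_left_mono degree_nonneg) (simp add: k_def)
      qed simp
    qed
    also have "\<dots> \<le> ?H"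
      by (rule degree_entropy_le)
    finally show ?thesis .
  qed
  \<comment> \<open>Of the two factors \<open>\<epsilon>\<close>, one is absorbed by the energy
    budget and the other survives, uniformly in \<open>n\<close>.\<close>
  have error: "(\<Sum>t<n. \<epsilon>\<^sup>2 * \<bar>dirichlet (u t e) (u t f)\<bar>)
      \<le> \<epsilon> * ((dirichlet (y e) (y e) + dirichlet (y f) (y f)) / 2)" for n e f
  proof -
    have "(\<Sum>t<n. \<epsilon>\<^sup>2 * \<bar>dirichlet (u t e) (u t f)\<bar>)
        \<le> (\<Sum>t<n. \<epsilon>\<^sup>2 * (inner (u t e) (mass_op (u t e)) + inner (u t f) (mass_op (u t f))))"
    proof (intro sum_mono mult_left_mono)
      fix t
      show "\<bar>dirichlet (u t e) (u t f)\<bar> \<le> inner (u t e) (mass_op (u t e)) + inner (u t f) (mass_op (u t f))"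
        using abs_dirichlet_le[of "u t e" "u t f"] dirichlet_le_mass_norm[of "u t e"]
          dirichlet_le_mass_norm[of "u t f"] by simp
    qed simp
    also have "\<dots> = \<epsilon> / 2 * ((\<Sum>t<n. 2 * \<epsilon> * inner (u t e) (mass_op (u t e)))
        + (\<Sum>t<n. 2 * \<epsilon> * inner (u t f) (mass_op (u t f))))"
      by (simp add: sum_distrib_left sum.distrib power2_eq_square algebra_simps)
    also have "\<dots> \<le> \<epsilon> / 2 * (dirichlet (y e) (y e) + dirichlet (y f) (y f))"
      unfolding u_def using eps_pos
      by (intro mult_left_mono add_mono sum_mass_norm_le lap_y) simp
    finally show ?thesis
      by simp
  qed
  have "?F \<le> ?H + \<epsilon> * ?C + R n" for n
  proof -
    have "?F \<le> (\<Sum>e\<in>UNIV. \<Sum>f\<in>UNIV. 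
        (dirichlet ((step ^^ n) (y e)) ((step ^^ n) (y e)) + dirichlet ((step ^^ n) (y f)) ((step ^^ n) (y f))) / 2
        + ((\<Sum>t<n. 2 * \<epsilon> * \<bar>inner (u t e) (mass_op (u t f))\<bar>)
        + \<epsilon> * ((dirichlet (y e) (y e) + dirichlet (y f) (y f)) / 2)))"
    proof (intro sum_mono)
      fix e f
      have "\<bar>dirichlet (y e) (y f)\<bar> \<le> \<bar>dirichlet ((step ^^ n) (y e)) ((step ^^ n) (y f))\<bar>
          + (\<Sum>t<n. \<bar>2 * \<epsilon> * inner (u t e) (mass_op (u t f)) + \<epsilon>\<^sup>2 * dirichlet (u t e) (u t f)\<bar>)"
        unfolding dirichlet_telescope[OF lap_y lap_y, of e f n] u_def
        by (rule order_trans[OF abs_triangle_ineq]) (intro add_left_mono sum_abs)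
      also have "(\<Sum>t<n. \<bar>2 * \<epsilon> * inner (u t e) (mass_op (u t f)) + \<epsilon>\<^sup>2 * dirichlet (u t e) (u t f)\<bar>)
          \<le> (\<Sum>t<n. 2 * \<epsilon> * \<bar>inner (u t e) (mass_op (u t f))\<bar> + \<epsilon>\<^sup>2 * \<bar>dirichlet (u t e) (u t f)\<bar>)"
        using eps_pos by (intro sum_mono order_trans[OF abs_triangle_ineq]) (simp add: abs_mult)
      finally show "\<bar>dirichlet (y e) (y f)\<bar> \<le> (dirichlet ((step ^^ n) (y e)) ((step ^^ n) (y e))
            + dirichlet ((step ^^ n) (y f)) ((step ^^ n) (y f))) / 2
          + ((\<Sum>t<n. 2 * \<epsilon> * \<bar>inner (u t e) (mass_op (u t f))\<bar>)
          + \<epsilon> * ((dirichlet (y e) (y e) + dirichlet (y f) (y f)) / 2))"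
        using error[where n = n and e = e and f = f]
          abs_dirichlet_le[of "(step ^^ n) (y e)" "(step ^^ n) (y f)"]
        unfolding sum.distrib by linarith
    qed
    also have "\<dots> = R n + ((\<Sum>e\<in>UNIV. \<Sum>f\<in>UNIV. \<Sum>t<n. 2 * \<epsilon> * \<bar>inner (u t e) (mass_op (u t f))\<bar>) + \<epsilon> * ?C)"
      unfolding R_def sum.distrib sum_distrib_left by (rule refl)
    also have "(\<Sum>e\<in>UNIV. \<Sum>f\<in>UNIV. \<Sum>t<n. 2 * \<epsilon> * \<bar>inner (u t e) (mass_op (u t f))\<bar>)
        = (\<Sum>e\<in>UNIV. \<Sum>t<n. \<Sum>f\<in>UNIV. 2 * \<epsilon> * \<bar>inner (u t e) (mass_op (u t f))\<bar>)"
      by (intro sum.cong refl sum.swap)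
    also have "\<dots> = (\<Sum>t<n. \<Sum>e\<in>UNIV. \<Sum>f\<in>UNIV. 2 * \<epsilon> * \<bar>inner (u t e) (mass_op (u t f))\<bar>)"
      by (rule sum.swap)
    also have "\<dots> \<le> ?H"
      using sum_mono[OF main] entropy by (rule order_trans)
    finally show ?thesis
      by simp
  qed
  \<comment> \<open>Time tends to infinity with the step length fixed.\<close>
  moreover have "R \<longlonglongrightarrow> 0"
    unfolding R_def
    by (intro tendsto_null_sum tendsto_divide_zero tendsto_add_zero dirichlet_funpow_tendsto_0[OF lap_y])
  then have "(\<lambda>n. ?H + \<epsilon> * ?C + R n) \<longlonglongrightarrow> ?H + \<epsilon> * ?C + 0"
    by (intro tendsto_add tendsto_const)
  ultimately show ?thesis
    using LIMSEQ_le_const by force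
qed

end

section \<open>Currents as Dirichlet products, and vanishing step length\<close>

context multigraph
begin

lemma transpose_laplacian: "transpose (laplacian tail head) = laplacian tail head"
  by (simp add: laplacian_def matrix_transpose_mul)

text \<open>With the transpose, pairing \<open>potential f\<close> with a vector is pairing the edge
  vector of \<open>f\<close> with the pseudoinverse image of that vector, as in
  \<open>current\<close>.\<close>

definition potential :: "'e \<Rightarrow> real^'v" where
  "potential e = transpose (pinv (laplacian tail head)) *v edge_vec tail head e"

text \<open>Write \<open>X\<close> for the pseudoinverse. \<open>X L w\<close> and \<open>w\<close>
  differ by a vector in the kernel of \<open>L\<close>, whose energy and hence gradient is 0. Edge
  vectors only see gradients, so pairing with any \<open>w\<close> gives the claim.\<close>

lemma lap_potential: "lap (potential e) = edge_vec tail head e"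
proof -
  let ?L = "laplacian tail head" and ?B = "incidence tail head"
  let ?X = "pinv ?L"
  have LXL: "?L ** ?X ** ?L = ?L"
    using is_pinv_pinv[OF transpose_laplacian] by (simp add: is_pinv_def)
  have BXL: "?B *v (?X *v (?L *v w)) = ?B *v w" for w
  proof -
    define d where "d = ?X *v (?L *v w) - w"
    have "lap d = 0"
      unfolding lap_def d_def using LXL
      by (metis (no_types, lifting) diff_self matrix_vector_mul_assoc matrix_vector_mult_diff_distrib)
    then have "(\<Sum>e\<in>UNIV. grad d e * grad d e) = 0"
      using inner_lap[of d d] by simp
    then have "grad d e = 0" for e
      by (subst (asm) sum_nonneg_eq_0_iff) auto
    then have "grad (?X *v (?L *v w)) e = grad w e" for e
      by (simp add: d_def grad_def algebra_simps)
    then show ?thesis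
      by (simp add: vec_eq_iff incidence_mult)
  qed
  have "inner (lap (potential e)) w = inner (edge_vec tail head e) w" for w
  proof -
    have "inner (lap (potential e)) w = inner (edge_vec tail head e) (?X *v (?L *v w))"
      using inner_transpose_mult[of ?L "potential e" w]
      unfolding lap_def potential_def transpose_laplacian by (simp only: inner_transpose_mult)
    also have "\<dots> = inner (edge_vec tail head e) w"
      using BXL[of w] by (metis inner_edge_vec incidence_mult)
    finally show ?thesis .
  qed
  then show ?thesis
    by (metis vector_eq_rdot)
qed

text \<open>The entry is the pairing of \<open>potential f\<close> with the edge vector of
  \<open>e\<close>, and that vector is \<open>lap (potential e)\<close>.\<close>

lemma current_nth: "current tail head e $ f = (\<Sum>g\<in>UNIV. grad (potential e) g * grad (potential f) g)"
proof -
  have "current tail head e $ f = inner (edge_vec tail head f) (pinv (laplacian tail head) *v edge_vec tail head e)"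
    by (simp add: current_def incidence_mult inner_edge_vec)
  also have "\<dots> = inner (potential f) (lap (potential e))"
    unfolding lap_potential by (simp only: potential_def inner_transpose_mult)
  finally show ?thesis
    by (simp add: inner_lap mult.commute)
qed

lemma sum_abs_current_le:
  "(\<Sum>e\<in>UNIV. \<Sum>f\<in>UNIV. \<bar>current tail head e $ f\<bar>) \<le> 2 * real CARD('e) * ln (real CARD('v))"
proof -
  define D where "D e f = (\<Sum>g\<in>UNIV. grad (potential e) g * grad (potential f) g)" for e f
  define F where "F = (\<Sum>e\<in>UNIV. \<Sum>f\<in>UNIV. \<bar>D e f\<bar>)"
  define H where "H = 2 * real CARD('e) * ln (real CARD('v))"
  define C where "C = (\<Sum>e\<in>UNIV. \<Sum>f\<in>UNIV. (D e e + D f f) / 2)"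
  have le: "F \<le> H + \<epsilon> * C" if "0 < \<epsilon>" for \<epsilon>
  proof -
    interpret heat_scheme tail head \<epsilon>
      using that by unfold_locales
    show ?thesis
      using sum_transfer_current_le_eps[of potential, OF lap_potential]
      by (simp add: F_def H_def C_def D_def dirichlet_def)
  qed
  \<comment> \<open>\<open>F\<close>, \<open>H\<close> and \<open>C\<close> do not depend on the
    step length.\<close>
  have "((\<lambda>\<epsilon>. H + \<epsilon> * C) \<longlongrightarrow> H + 0 * C) (at_right 0)"
    by (intro tendsto_intros)
  then have "F \<le> H + 0 * C"
    by (rule tendsto_lowerbound) (use le in \<open>auto simp: eventually_at_right_less eventually_at_filter\<close>)
  then show ?thesis
    by (simp add: F_def H_def D_def current_nth)
qed

end

theorem theorem1p1:
  fixes tail head :: "'e::finite \<Rightarrow> 'v::finite"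
  assumes "CARD('v) \<ge> 2"
    and "\<And>e. tail e \<noteq> head e"
  shows "(1 / real CARD('e)) * (\<Sum>e\<in>UNIV. l1norm (current tail head e))
           \<le> 2 * ln (real CARD('v))"
proof -
  interpret multigraph tail head
    using assms(2) by unfold_locales
  show ?thesis
    using sum_abs_current_le by (simp add: l1norm_def field_simps)
qed

end
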